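(* Let $k$ be a positive integer such that $k \equiv 2 \bmod 4$, let $N$ be an odd $k$-perfect number, and let $n, \alpha$ be integers and $q$ a prime such that $N = n^{2}q^{\alpha}$, $q \nmid n$, and $q \equiv \alpha \equiv 1 \bmod 4$. Then the following hold. (1) If $\alpha = 1$, then $\frac{\sigma(n^{2})}{q} > 1$. (2) If $\alpha > 1$ and $\frac{k}{2}$ is a square, then $\frac{\sigma(n^{2})}{q^{\alpha}}$ is neither a square nor a square times a single prime; that is, there exist no integer $n_{0}$ and no $l$ which is either $1$ or a prime such that $\frac{\sigma(n^{2})}{q^{\alpha}} = l n_{0}^{2}$. (3) If $\alpha > 1$ and $\frac{k}{2}$ is a square times a single prime (i.e., $\frac{k}{2} = p m^{2}$ for some prime $p$ and some integer $m$), then $\frac{\sigma(n^{2})}{q^{\alpha}}$ is not the square of an integer. In any of the cases (1), (2), (3), $\sigma(n^{2}) \neq q^{\alpha}$.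
   Context: For a positive integer $m$, $\sigma(m)$ denotes the sum of the positive divisors of $m$. A positive integer $N$ is called $k$-perfect if $\sigma(N) = kN$. It is known that, when $k \equiv 2 \bmod 4$, every odd $k$-perfect number $N$ can be written as $N = n^{2}q^{\alpha}$ with $q$ prime, $q \nmid n$ and $q \equiv \alpha \equiv 1 \bmod 4$; in this situation $\frac{\sigma(n^{2})}{q^{\alpha}}$ is an integer. *)

theory Defs
  imports Complex_Main "HOL-Number_Theory.Number_Theory"
begin

(* Only meaningful for m > 0; for m = 0 the index set is infinite and the sum is 0 by convention. *)
definition sigma :: "int \<Rightarrow> int"
  where "sigma m = (\<Sum>d | 0 < d \<and> d dvd m. d)"

definition k_perfect :: "int \<Rightarrow> int \<Rightarrow> bool"
  where "k_perfect k N \<longleftrightarrow> 0 < N \<and> sigma N = k * N"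

end

theory Submission imports Defs "HOL-Computational_Algebra.Nth_Powers" begin

text \<open>
  Write \<open>s = sigma (n\<^sup>2) / q ^ \<alpha>\<close>. Multiplicativity of \<open>sigma\<close> turns perfection into
  \<open>s * sigma (q ^ \<alpha>) = k * n\<^sup>2\<close>.

  If \<open>\<alpha> = 1\<close> and \<open>s = 1\<close>, then \<open>sigma (n\<^sup>2)\<close> is the prime \<open>q = k * n\<^sup>2 - 1\<close>. A prime value of \<open>sigma\<close>
  forces \<open>n\<^sup>2\<close> to be a power of an odd prime \<open>p\<close>, and then \<open>sigma (n\<^sup>2) < p / (p - 1) * n\<^sup>2\<close> is far too
  small (\<open>sigma_square_ne_multiple_minus_one\<close>).

  If \<open>\<alpha> > 1\<close>, put \<open>\<alpha> + 1 = 2 * r\<close>, where \<open>r > 1\<close> is odd. Then \<open>sigma (q ^ \<alpha>) = 2 * A * B\<close> with the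
  coprime factors \<open>A = (q ^ r + 1) / 2\<close> and \<open>B = (q ^ r - 1) / (q - 1)\<close>. Each of the excluded
  shapes of \<open>s\<close> makes \<open>A * B\<close> a square, or a prime times a square, up to square factors; so \<open>A\<close> or
  \<open>B\<close> would have to be a square. Both are impossible.

  For \<open>B = y\<^sup>2\<close> we have \<open>q * u\<^sup>2 - (q - 1) * y\<^sup>2 = 1\<close> with \<open>u = q ^ ((r - 1) / 2)\<close>. This is a Pell-type
  equation with smallest solution \<open>(1, 1)\<close>, and its solutions \<open>u\<close> are values of Chebyshev
  polynomials. An argument in the style of Stoermer applies: the \<open>m\<close>-th such value is divisible by
  \<open>q\<close> at most as often as \<open>2 * m + 1\<close>, but exceeds \<open>2 * m + 1\<close> if \<open>m > 0\<close>; so it is a power of \<open>q\<close>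
  only when it is \<open>1\<close> (\<open>pell_prime_power_solution\<close>).

  For \<open>A = y\<^sup>2\<close> take a prime \<open>p\<close> dividing \<open>r\<close>, and let \<open>X = q ^ (r / p)\<close> and
  \<open>L = (X ^ p + 1) / (X + 1)\<close>. Then \<open>(X + 1) / 2 * L = y\<^sup>2\<close>, and the two factors have greatest common
  divisor \<open>1\<close> or \<open>p\<close>, so \<open>L\<close> is a square or \<open>p\<close> times a square. The first case is excluded by the
  argument above, now for \<open>X * u\<^sup>2 - (X + 1) * b\<^sup>2 = -1\<close>. In the second case \<open>X \<equiv> -1\<close> modulo \<open>p\<close>,
  and Jacobi symbols decide (\<open>alt_sum_ne_prime_times_square\<close>): for \<open>L\<^sub>m = (X ^ m + 1) / (X + 1)\<close>
  a Euclidean descent on the indices gives \<open>(L\<^sub>p / L\<^sub>m) = 1\<close> for every odd \<open>m\<close> prime to \<open>p\<close>, whereas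
  \<open>L\<^sub>p = p * b\<^sup>2\<close> and reciprocity give \<open>(L\<^sub>p / L\<^sub>m) = (p / L\<^sub>m) = (L\<^sub>m / p) = (m / p)\<close>, which is \<open>-1\<close>
  for a suitable \<open>m\<close>.
\<close>

section \<open>The Jacobi symbol\<close>

text \<open>
  The value is meaningful for odd \<open>n\<close> only: at \<open>p = 2\<close> the factor is not the Kronecker symbol.
\<close>

definition jacobi :: "int \<Rightarrow> nat \<Rightarrow> int"
  where "jacobi a n = (\<Prod>p\<in>#prime_factorization n. Legendre a (int p))"

lemma Legendre_cong:
  assumes "[a = b] (mod p)"
  shows "Legendre a p = Legendre b p"
proof -
  have "[x = a] (mod p) \<longleftrightarrow> [x = b] (mod p)" "[a = x] (mod p) \<longleftrightarrow> [b = x] (mod p)" for x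
    using assms by (auto simp: cong_def)
  then show ?thesis by (simp add: Legendre_def QuadRes_def)
qed

lemma Legendre_range: "Legendre a p \<in> {-1, 0, 1}"
  by (simp add: Legendre_def)

text \<open>Residues of \<open>-1\<close>, \<open>0\<close>, \<open>1\<close> modulo \<open>p > 2\<close> are distinct, which turns Euler's criterion, a congruence, into equations.\<close>

lemma Legendre_eqI:
  assumes "p > 2" "x \<in> {-1, 0, 1}" "y \<in> {-1, 0, 1 :: int}" "[x = y] (mod int p)"
  shows "x = y"
proof -
  have "int p dvd x - y" using assms(4) by (simp add: cong_iff_dvd_diff)
  moreover have "\<bar>x - y\<bar> < int p" using assms(1-3) by auto
  ultimately show ?thesis using dvd_imp_le_int[of "x - y" "int p"] by fastforce
qed

lemma Legendre_mult:
  assumes "prime p" "p > 2"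
  shows "Legendre (a * b) (int p) = Legendre a (int p) * Legendre b (int p)"
proof (rule Legendre_eqI[OF assms(2)])
  have "[Legendre (a * b) p = (a * b) ^ ((p - 1) div 2)] (mod p)"
    by (rule euler_criterion[OF assms])
  moreover have "[Legendre a p * Legendre b p = a ^ ((p - 1) div 2) * b ^ ((p - 1) div 2)] (mod p)"
    by (intro cong_mult euler_criterion[OF assms])
  ultimately show "[Legendre (a * b) p = Legendre a p * Legendre b p] (mod p)"
    by (simp add: cong_def power_mult_distrib)
qed (auto simp: Legendre_def)

lemma jacobi_one_right [simp]: "jacobi a 1 = 1" "jacobi a (Suc 0) = 1"
  by (simp_all add: jacobi_def)

lemma jacobi_prime: "prime p \<Longrightarrow> jacobi a p = Legendre a (int p)"
  by (simp add: jacobi_def prime_factorization_prime)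

lemma jacobi_mult_right:
  "m > 0 \<Longrightarrow> n > 0 \<Longrightarrow> jacobi a (m * n) = jacobi a m * jacobi a n"
  by (simp add: jacobi_def prime_factorization_mult)

lemma jacobi_cong:
  assumes "[a = b] (mod int n)"
  shows "jacobi a n = jacobi b n"
proof -
  have "Legendre a (int p) = Legendre b (int p)" if "p \<in># prime_factorization n" for p
  proof (rule Legendre_cong)
    have "int p dvd int n" using that by auto
    then show "[a = b] (mod int p)" using assms cong_dvd_modulus by blast
  qed
  then show ?thesis unfolding jacobi_def by (auto intro!: arg_cong[of _ _ prod_mset] image_mset_cong)
qed

lemma odd_prime_factor_gt_2:
  assumes "odd n" "p \<in># prime_factorization (n :: nat)"
  shows "prime p" "p > 2"
proof -
  show "prime p" using assms by auto
  moreover have "p \<noteq> 2" using assms by auto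
  ultimately show "p > 2" using prime_ge_2_nat[of p] by linarith
qed

lemma jacobi_mult_left:
  assumes "odd n"
  shows "jacobi (a * b) n = jacobi a n * jacobi b n"
proof -
  have "Legendre (a * b) (int p) = Legendre a (int p) * Legendre b (int p)"
    if "p \<in># prime_factorization n" for p
    using Legendre_mult odd_prime_factor_gt_2[OF assms that] by blast
  then have "jacobi (a * b) n =
      (\<Prod>p\<in>#prime_factorization n. Legendre a (int p) * Legendre b (int p))"
    unfolding jacobi_def by (auto intro!: arg_cong[of _ _ prod_mset] image_mset_cong)
  then show ?thesis by (simp add: jacobi_def prod_mset.distrib)
qed

lemma jacobi_one_left [simp]: "jacobi 1 n = 1"
proof -
  have "Legendre 1 (int p) = 1" if "p \<in># prime_factorization n" for p
  proof -
    have "prime p" using that by auto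
    then have "\<not> [1 = 0] (mod int p)" by (auto simp: cong_0_iff)
    moreover have "QuadRes (int p) 1" unfolding QuadRes_def by (rule exI[of _ 1]) simp
    ultimately show ?thesis by (simp add: Legendre_def)
  qed
  then show ?thesis by (simp add: jacobi_def cong: image_mset_cong)
qed

lemma jacobi_power_left:
  assumes "odd n"
  shows "jacobi (a ^ e) n = jacobi a n ^ e"
  by (induction e) (simp_all add: jacobi_mult_left[OF assms])

lemma jacobi_range: "jacobi a n \<in> {-1, 0, 1}"
proof -
  have "prod_mset (image_mset f M) \<in> {-1, 0, 1}" if "\<And>p. f p \<in> {-1, 0, 1 :: int}"
    for f :: "nat \<Rightarrow> int" and M
  proof (induction M)
    case (add x M)
    then show ?case using that[of x] by (auto simp del: prod_mset_zero_iff)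
  qed simp
  then show ?thesis unfolding jacobi_def using Legendre_range by metis
qed

lemma odd_nat_prime_induct [consumes 1, case_names one mult]:
  assumes "odd (n :: nat)" "P 1"
    "\<And>p m. prime p \<Longrightarrow> odd p \<Longrightarrow> odd m \<Longrightarrow> P m \<Longrightarrow> P (p * m)"
  shows "P n"
proof -
  have "odd n \<longrightarrow> P n"
    by (induction n rule: prime_divisors_induct) (use assms in auto)
  then show ?thesis using assms(1) by blast
qed

text \<open>If \<open>m = 2 * i + 1\<close> and \<open>n = 2 * j + 1\<close>, then \<open>(m * n - 1) / 2 = 2 * i * j + i + j\<close>.\<close>

lemma sign_mult:
  assumes "odd (m :: nat)" "odd n"
  shows "((-1) ^ ((m * n - 1) div 2) :: int) = (-1) ^ ((m - 1) div 2) * (-1) ^ ((n - 1) div 2)"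
proof -
  obtain i j where "m = 2 * i + 1" "n = 2 * j + 1" using assms by (auto elim!: oddE)
  moreover have "(2 * i + 1) * (2 * j + 1) - 1 = 2 * (2 * (i * j) + i + j)" by (simp add: algebra_simps)
  ultimately show ?thesis by (simp add: power_add power_mult)
qed

lemma odd_if_cong_1_mod_4:
  assumes "[k = 1] (mod 4)"
  shows "odd (k :: nat)"
proof -
  have "k mod 4 = 1" using assms by (simp add: cong_def)
  then show ?thesis by presburger
qed

lemma jacobi_minus_one:
  assumes "odd n"
  shows "jacobi (-1) n = (-1) ^ ((n - 1) div 2)"
  using assms
proof (induction n rule: odd_nat_prime_induct)
  case (mult p m)
  have "p > 2" using mult(1,2) prime_ge_2_nat[of p] by (cases "p = 2") auto
  have "Legendre (-1) (int p) = (-1) ^ ((p - 1) div 2)"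
  proof (rule Legendre_eqI[OF \<open>p > 2\<close>])
    show "[Legendre (-1) (int p) = (-1) ^ ((p - 1) div 2)] (mod int p)"
      by (rule euler_criterion[OF mult(1) \<open>p > 2\<close>])
    show "(-1) ^ ((p - 1) div 2) \<in> {-1, 0, 1 :: int}"
      by (cases "even ((p - 1) div 2)") auto
  qed (rule Legendre_range)
  moreover have "m > 0" "p > 0" using mult by (auto intro: Nat.gr0I prime_gt_0_nat)
  ultimately show ?case
    using mult sign_mult[of p m] by (simp add: jacobi_mult_right jacobi_prime)
qed simp

lemma jacobi_minus_one_1_mod_4:
  assumes "[n = 1] (mod 4)"
  shows "jacobi (-1) n = 1"
proof -
  have "n mod 4 = 1" using assms by (simp add: cong_def)
  then have "even ((n - 1) div 2)" by presburger
  then show ?thesis using jacobi_minus_one[OF odd_if_cong_1_mod_4[OF assms]] by simp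
qed

text \<open>Both sides are multiplicative in \<open>a\<close> and in \<open>b\<close>, so quadratic reciprocity for primes extends by an
  induction over the prime factors of each argument, first of \<open>b\<close> for prime \<open>a\<close>, then of \<open>a\<close>.\<close>

lemma jacobi_reciprocity:
  assumes "odd a" "odd b" "coprime a b"
  shows "jacobi (int a) b * jacobi (int b) a = (-1) ^ ((a - 1) div 2 * ((b - 1) div 2))"
  using assms
proof (induction a rule: odd_nat_prime_induct)
  case one
  then show ?case by simp
next
  case (mult p m)
  have pm: "p > 0" "m > 0" using mult by (auto intro: Nat.gr0I prime_gt_0_nat)
  have "p > 2" using mult(1,2) prime_ge_2_nat[of p] by (cases "p = 2") auto
  have P: "jacobi (int p) b * jacobi (int b) p = (-1) ^ ((p - 1) div 2 * ((b - 1) div 2))"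
    if "odd b" "coprime p b" for b
    using that
  proof (induction b rule: odd_nat_prime_induct)
    case (mult q l)
    note q = \<open>prime q\<close> \<open>odd q\<close>
    have "q > 2" using q prime_ge_2_nat[of q] by (cases "q = 2") auto
    have "p \<noteq> q" using mult.prems q by auto
    have "l > 0" "q > 0" using mult by (auto intro: Nat.gr0I prime_gt_0_nat)
    have QR: "Legendre (int p) (int q) * Legendre (int q) (int p) = (-1) ^ ((p - 1) div 2 * ((q - 1) div 2))"
      using Quadratic_Reciprocity \<open>prime p\<close> \<open>p > 2\<close> q \<open>q > 2\<close> \<open>p \<noteq> q\<close> by blast
    have "jacobi (int p) (q * l) * jacobi (int (q * l)) p =
       (Legendre (int p) (int q) * Legendre (int q) (int p)) * (jacobi (int p) l * jacobi (int l) p)"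
      using \<open>l > 0\<close> \<open>q > 0\<close> \<open>odd p\<close> q \<open>prime p\<close>
      by (simp add: jacobi_mult_right jacobi_mult_left jacobi_prime[symmetric] ac_simps)
    also have "\<dots> = (-1) ^ ((p - 1) div 2 * ((q - 1) div 2)) * (-1) ^ ((p - 1) div 2 * ((l - 1) div 2))"
      using QR mult by simp
    also have "\<dots> = (-1) ^ ((p - 1) div 2 * ((q * l - 1) div 2))"
      using sign_mult[OF \<open>odd q\<close> \<open>odd l\<close>]
      by (simp only: power_mult power_mult_distrib mult.commute[of "(p - 1) div 2"])
    finally show ?case .
  qed simp
  have "jacobi (int (p * m)) b * jacobi (int b) (p * m) =
     (jacobi (int p) b * jacobi (int b) p) * (jacobi (int m) b * jacobi (int b) m)"
    using pm mult.prems by (simp add: jacobi_mult_right jacobi_mult_left ac_simps)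
  also have "\<dots> = (-1) ^ ((p - 1) div 2 * ((b - 1) div 2)) * (-1) ^ ((m - 1) div 2 * ((b - 1) div 2))"
    using mult P by simp
  also have "\<dots> = (-1) ^ ((p * m - 1) div 2 * ((b - 1) div 2))"
    using sign_mult[OF \<open>odd p\<close> \<open>odd m\<close>] by (simp only: power_mult power_mult_distrib)
  finally show ?case .
qed

lemma jacobi_reciprocity_1_mod_4:
  assumes "odd a" "odd b" "coprime a b" "[b = 1] (mod 4)"
  shows "jacobi (int a) b = jacobi (int b) a"
proof -
  have "b mod 4 = 1" using assms(4) by (simp add: cong_def)
  then have "even ((b - 1) div 2)" by presburger
  then have "jacobi (int a) b * jacobi (int b) a = 1"
    using jacobi_reciprocity[OF assms(1-3)] by simp
  then show ?thesis using jacobi_range[of "int a" b] by auto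
qed

section \<open>Alternating geometric sums\<close>

text \<open>
  For odd \<open>m\<close> this is \<open>(X ^ m + 1) / (X + 1)\<close>. Allowing every \<open>m\<close> makes the addition formula
  available without parity conditions.
\<close>

definition alt_sum :: "int \<Rightarrow> nat \<Rightarrow> int"
  where "alt_sum X m = (\<Sum>i<m. (- X) ^ i)"

lemma alt_sum_mult: "(X + 1) * alt_sum X m = 1 - (- X) ^ m"
  using one_diff_power_eq[of "-X" m] by (simp add: alt_sum_def algebra_simps)

lemma alt_sum_add: "alt_sum X (m + n) = alt_sum X m + (- X) ^ m * alt_sum X n"
  by (induction n) (simp_all add: alt_sum_def power_add algebra_simps)

lemma alt_sum_pos:
  assumes "X > 0" "odd m"
  shows "alt_sum X m > 0"
proof -
  have "X ^ m > 0" using assms(1) by simp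
  then have "(X + 1) * alt_sum X m > 0" using assms(2) by (simp add: alt_sum_mult)
  then show ?thesis using assms(1) by (simp add: zero_less_mult_iff)
qed

lemma alt_sum_cong:
  assumes "[X = -1] (mod M)"
  shows "[alt_sum X m = int m] (mod M)"
proof -
  have "[- X = 1] (mod M)" using cong_minus_minus_iff[of X "-1" M] assms by simp
  then have "[(- X) ^ i = 1] (mod M)" for i using cong_pow[of "-X" 1 M i] by simp
  then have "[(\<Sum>i<m. (- X) ^ i) = (\<Sum>i<m. 1)] (mod M)" by (intro cong_sum) auto
  then show ?thesis by (simp add: alt_sum_def)
qed

lemma alt_sum_mod_4:
  assumes "[X = 1] (mod 4)" "odd m"
  shows "[alt_sum X m = 1] (mod 4)"
proof -
  have "[- X = -1] (mod 4)" using assms(1) by (simp add: cong_minus_minus_iff)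
  then have "[(- X) ^ i = (-1) ^ i] (mod 4)" for i by (rule cong_pow)
  then have "[alt_sum X m = (\<Sum>i<m. (-1) ^ i)] (mod 4)"
    unfolding alt_sum_def by (intro cong_sum) auto
  moreover have "(\<Sum>i<m. (-1) ^ i) = (1 :: int)"
    using one_diff_power_eq[of "-1 :: int" m] assms(2) by simp
  ultimately show ?thesis by simp
qed

lemma alt_sum_mod_X:
  assumes "m > 0"
  shows "[alt_sum X m = 1] (mod X)"
proof -
  have "alt_sum X (1 + (m - 1)) = 1 - X * alt_sum X (m - 1)"
    by (subst alt_sum_add) (simp add: alt_sum_def)
  then have "alt_sum X m - 1 = X * (- alt_sum X (m - 1))" using assms by simp
  then show ?thesis by (simp add: cong_iff_dvd_diff)
qed

text \<open>The subtractive Euclidean algorithm on the indices, as for \<open>gcd (x ^ a - 1) (x ^ b - 1)\<close>.\<close>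

lemma alt_sum_coprime:
  assumes "coprime a b" "a > 0" "b > 0"
  shows "coprime (alt_sum X a) (alt_sum X b)"
  using assms
proof (induction "a + b" arbitrary: a b rule: less_induct)
  case less
  have *: "coprime (alt_sum X a) (alt_sum X b)"
    if ab: "coprime a b" "a > 0" "b > a" "a + b = x + y" and IH: "\<And>c d. c + d < x + y \<Longrightarrow> coprime c d \<Longrightarrow> c > 0 \<Longrightarrow> d > 0 \<Longrightarrow> coprime (alt_sum X c) (alt_sum X d)" for a b x y
  proof -
    define c where "c = b - a"
    have c: "b = a + c" "c > 0" using ab(3) by (simp_all add: c_def)
    have "coprime a c" using ab(1) unfolding c(1) coprime_iff_gcd_eq_1 by simp
    then have 1: "coprime (alt_sum X a) (alt_sum X c)" using IH[of a c] ab c by simp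
    have "[1 = alt_sum X a] (mod X)" using alt_sum_mod_X[OF ab(2)] by (rule cong_sym)
    then have "coprime (alt_sum X a) X" by (rule cong_imp_coprime) simp
    then have "coprime (alt_sum X a) ((- X) ^ a)" by simp
    with 1 have "coprime (alt_sum X a) ((- X) ^ a * alt_sum X c)" by simp
    then show ?thesis unfolding c(1) alt_sum_add coprime_iff_gcd_eq_1 by simp
  qed
  consider "a = b" | "a < b" | "b < a" by linarith
  then show ?case
  proof cases
    case 1
    then have "a = 1" using less.prems by simp
    then show ?thesis using 1 by (simp add: alt_sum_def)
  next
    case 2
    show ?thesis by (rule *[of a b a b]) (use 2 less in auto)
  next
    case 3
    have "coprime (alt_sum X b) (alt_sum X a)"
      by (rule *[of b a a b]) (use 3 less in \<open>auto simp: coprime_commute\<close>)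
    then show ?thesis by (simp add: coprime_commute)
  qed
qed

text \<open>Write \<open>L\<^sub>m\<close> for \<open>alt_sum X m\<close>. Since \<open>(- X) ^ b \<equiv> 1\<close> modulo \<open>L\<^sub>b\<close>, the value of \<open>L\<^sub>a\<close> modulo \<open>L\<^sub>b\<close>
  depends, up to a power of \<open>- X\<close> and a sign, on \<open>a\<close> modulo \<open>b\<close> only, and reciprocity allows
  exchanging \<open>a\<close> and \<open>b\<close>. The symbols picked up on the way are all \<open>1\<close>: \<open>(-1 / L\<^sub>b) = 1\<close> as
  \<open>L\<^sub>b \<equiv> 1\<close> modulo \<open>4\<close>, and \<open>(X / L\<^sub>b) = (L\<^sub>b / X) = (1 / X) = 1\<close>. To stay among odd indices, where the
  symbol is defined, the descent replaces \<open>a\<close> by \<open>a - 2 * b\<close> or by \<open>2 * b - a\<close>.\<close>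

lemma jacobi_alt_sum:
  assumes X: "X > 0" "[X = 1] (mod 4)" and "odd a" "odd b" "coprime a b"
  shows "jacobi (alt_sum X a) (nat (alt_sum X b)) = 1"
  using assms(3-)
proof (induction "a + b" arbitrary: a b rule: less_induct)
  case less
  let ?L = "alt_sum X"
  have pos: "?L m > 0" "odd (nat (?L m))" "[nat (?L m) = 1] (mod 4)" if "odd m" for m
  proof -
    show "?L m > 0" using alt_sum_pos X that by blast
    have "[?L m = 1] (mod 4)" using alt_sum_mod_4 X that by blast
    then show "[nat (?L m) = 1] (mod 4)"
      using \<open>?L m > 0\<close> cong_int_iff[of "nat (?L m)" 1 4] by simp
    then show "odd (nat (?L m))"
      by (rule odd_if_cong_1_mod_4)
  qed
  have main: "jacobi (?L a) (nat (?L b)) = 1"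
    if ab: "b < a" "odd a" "odd b" "coprime a b" "a + b = s"
      and IH: "\<And>c d. c + d < s \<Longrightarrow> odd c \<Longrightarrow> odd d \<Longrightarrow> coprime c d \<Longrightarrow> jacobi (?L c) (nat (?L d)) = 1"
    for a b s
  proof -
    let ?n = "nat (?L b)"
    have n: "int ?n = ?L b" using pos[OF ab(3)] by simp
    have oddn: "odd ?n" using pos ab by blast
    have Y: "[(- X) ^ b = 1] (mod ?L b)"
    proof -
      have "(- X) ^ b - 1 = ?L b * (- (X + 1))"
        using alt_sum_mult[of X b] by (simp add: algebra_simps)
      then show ?thesis by (simp add: cong_iff_dvd_diff)
    qed
    show ?thesis
    proof (cases "2 * b < a")
      case True
      define c where "c = a - 2 * b"
      have c: "a = b + (b + c)" using True by (simp add: c_def)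
      have "odd c" using ab(2) unfolding c by simp blast
      have "a = c + b + b" using c by simp
      then have "gcd a b = gcd c b" by simp
      then have "coprime c b" using ab(4) unfolding coprime_iff_gcd_eq_1 by simp
      have "[?L a = 0 + 1 * (0 + 1 * ?L c)] (mod ?L b)"
        unfolding c alt_sum_add by (intro cong_add cong_mult Y cong_refl) (simp_all add: cong_0_iff)
      then have "jacobi (?L a) ?n = jacobi (?L c) ?n" by (intro jacobi_cong, unfold n) simp
      also have "\<dots> = 1"
      proof (rule IH)
        show "c + b < s" using ab(5) c odd_pos[OF ab(3)] by linarith
      qed fact+
      finally show ?thesis .
    next
      case False
      have "a \<noteq> 2 * b" using ab by auto
      \<comment> \<open>Reflecting \<open>a\<close> at \<open>b\<close> keeps the index odd; the sign \<open>-1\<close> and the power of \<open>- X\<close> have symbol \<open>1\<close>.\<close>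
      define e where "e = 2 * b - a"
      have e: "e + a = b + b" "e < b" "odd e" using False ab \<open>a \<noteq> 2 * b\<close> by (auto simp: e_def)
      have "coprime e b"
      proof (rule coprimeI)
        fix d assume "d dvd e" "d dvd b"
        then have "d dvd e + a" using e(1) by simp
        then have "d dvd a" using \<open>d dvd e\<close> by (simp add: dvd_add_right_iff)
        then show "is_unit d" using \<open>d dvd b\<close> ab(4) coprime_common_divisor by blast
      qed
      have "?L e + (- X) ^ e * ?L a = ?L b + (- X) ^ b * ?L b"
        unfolding alt_sum_add[symmetric] e(1) ..
      then have "(- X) ^ e * ?L a - (-1) * ?L e = ?L b * (1 + (- X) ^ b)" by (simp add: algebra_simps)
      then have "[(- X) ^ e * ?L a = (-1) * ?L e] (mod ?L b)" by (simp add: cong_iff_dvd_diff)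
      then have "jacobi ((- X) ^ e * ?L a) ?n = jacobi ((-1) * ?L e) ?n"
        by (intro jacobi_cong, unfold n) simp
      moreover have "jacobi (?L e) ?n = 1"
        by (rule IH) (use e ab \<open>coprime e b\<close> in auto)
      moreover have m1: "jacobi (-1) ?n = 1"
        using jacobi_minus_one_1_mod_4[OF pos(3)[OF ab(3)]] .
      moreover have "jacobi X ?n = 1"
      proof -
        have "b > 0" using ab(3) by (rule odd_pos)
        then have LX: "[?L b = 1] (mod X)" by (rule alt_sum_mod_X)
        have "X mod 4 = 1" using X(2) by (simp add: cong_def)
        then have "odd X" by presburger
        then have "odd (nat X)" using X(1) by (simp add: even_nat_iff)
        have "coprime X (?L b)" using cong_imp_coprime[OF cong_sym[OF LX]] by (simp add: coprime_commute)
        then have "coprime (nat X) ?n"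
          using coprime_int_iff[of "nat X" ?n] X(1) n by simp
        then have "jacobi (int (nat X)) ?n = jacobi (int ?n) (nat X)"
          using jacobi_reciprocity_1_mod_4[OF \<open>odd (nat X)\<close> oddn] pos(3) ab by blast
        also have "\<dots> = jacobi 1 (nat X)" by (rule jacobi_cong) (use LX X(1) n in simp)
        finally show ?thesis using X(1) by simp
      qed
      ultimately show ?thesis
        using jacobi_mult_left[OF oddn, of "-1" X] jacobi_mult_left[OF oddn, of "-1" "?L e"] by (simp add: jacobi_mult_left[OF oddn] jacobi_power_left[OF oddn])
    qed
  qed
  consider "a = b" | "a < b" | "b < a" by linarith
  then show ?case
  proof cases
    case 1
    then have "b = 1" using less.prems by simp
    then show ?thesis by (simp add: alt_sum_def)
  next
    case 2
    have ba: "jacobi (?L b) (nat (?L a)) = 1"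
      by (rule main[of a b "a + b"]) (use 2 less in \<open>auto simp: coprime_commute\<close>)
    have "coprime (nat (?L a)) (nat (?L b))"
      using alt_sum_coprime[of a b X] pos(1)[of a] pos(1)[of b] less.prems
        coprime_int_iff[of "nat (?L a)" "nat (?L b)"] by (simp add: odd_pos)
    then have "jacobi (int (nat (?L a))) (nat (?L b)) = jacobi (int (nat (?L b))) (nat (?L a))"
      using pos less.prems by (intro jacobi_reciprocity_1_mod_4) auto
    moreover have "int (nat (?L a)) = ?L a" "int (nat (?L b)) = ?L b"
      using pos(1)[of a] pos(1)[of b] less.prems by simp_all
    ultimately show ?thesis using ba by (simp only:)
  next
    case 3
    show ?thesis by (rule main[of b a "a + b"]) (use 3 less in auto)
  qed
qed

text \<open>A primitive root is a non-residue, and adding the odd number \<open>p\<close> adjusts its parity.\<close>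

lemma exists_quadratic_nonresidue:
  assumes "prime p" "p > 2"
  obtains m :: nat where "odd m" "Legendre (int m) (int p) = -1"
proof -
  obtain g where "residue_primroot p g"
    using prime_primitive_root_exists[of p] assms by auto
  then have g: "coprime p g" "ord p g = p - 1"
    using assms by (auto simp: residue_primroot_def totient_prime)
  have "Legendre (int g) (int p) \<noteq> 1"
  proof
    assume "Legendre (int g) (int p) = 1"
    then have "[1 = int g ^ ((p - 1) div 2)] (mod int p)"
      using euler_criterion[OF assms, of "int g"] by simp
    then have "[int (g ^ ((p - 1) div 2)) = int 1] (mod int p)" by (simp add: cong_sym)
    then have "[g ^ ((p - 1) div 2) = 1] (mod p)" by (simp only: cong_int_iff)
    then have "p - 1 dvd (p - 1) div 2" using ord_divides[of g "(p - 1) div 2" p] g(2) by simp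
    then have "p - 1 \<le> (p - 1) div 2" using assms by (intro dvd_imp_le) auto
    then show False using assms by linarith
  qed
  moreover have "\<not> [int g = 0] (mod int p)"
  proof
    assume "[int g = 0] (mod int p)"
    then have "p dvd g" by (simp add: cong_0_iff)
    then show False using g(1) assms(1) by (metis coprime_common_divisor dvd_refl not_prime_unit)
  qed
  ultimately have L: "Legendre (int g) (int p) = -1" by (auto simp: Legendre_def split: if_splits)
  show thesis
  proof (cases "odd g")
    case True
    then show thesis using that L by blast
  next
    case False
    have "odd p" using assms prime_odd_nat by blast
    then have "odd (g + p)" using False by simp
    moreover have "Legendre (int (g + p)) (int p) = -1"
      using L Legendre_cong[of "int (g + p)" "int g" "int p"] by (simp add: cong_def)
    ultimately show thesis using that by blast
  qed
qed

text \<open>As \<open>X \<equiv> -1\<close> modulo \<open>p\<close>, every \<open>alt_sum X m\<close> is congruent to \<open>m\<close> modulo \<open>p\<close>. The contradiction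
  comes from comparing Jacobi symbols to the modulus \<open>alt_sum X m\<close> for a non-residue \<open>m\<close>.\<close>

lemma alt_sum_ne_prime_times_square:
  assumes X: "X > 0" "[X = 1] (mod 4)" and p: "prime p" "p > 2" "[X = -1] (mod int p)"
  shows "alt_sum X p \<noteq> int p * b\<^sup>2"
proof
  assume eq: "alt_sum X p = int p * b\<^sup>2"
  obtain m where m: "odd m" "Legendre (int m) (int p) = -1"
    using exists_quadratic_nonresidue[OF p(1,2)] .
  have "\<not> int p dvd int m"
    using m(2) by (auto simp: Legendre_def cong_0_iff split: if_splits)
  then have cop: "coprime p m" using p(1) prime_imp_coprime int_dvd_int_iff by blast
  have "odd p" using p prime_odd_nat by blast
  define n where "n = nat (alt_sum X m)"
  have n: "int n = alt_sum X m" using alt_sum_pos[OF X(1) m(1)] by (simp add: n_def)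
  have "[int n = 1] (mod 4)" using alt_sum_mod_4[OF X(2) m(1)] n by simp
  then have n4: "[n = 1] (mod 4)" using cong_int_iff[of n 1 4] by simp
  then have "odd n" by (rule odd_if_cong_1_mod_4)
  have nm: "[int n = int m] (mod int p)" using alt_sum_cong[OF p(3)] n by simp
  then have "coprime n p"
    using cong_imp_coprime[OF cong_sym[OF nm]] cop by (simp add: coprime_commute)
  have "1 = jacobi (int p * b\<^sup>2) n"
    using jacobi_alt_sum[OF X \<open>odd p\<close> m(1) cop] eq by (simp add: n_def)
  also have "\<dots> = jacobi (int p) n * (jacobi b n)\<^sup>2"
    using \<open>odd n\<close> by (simp add: jacobi_mult_left power2_eq_square)
  finally have "jacobi (int p) n = 1"
    using jacobi_range[of b n] by auto
  also have "jacobi (int p) n = jacobi (int n) p"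
    using \<open>odd p\<close> \<open>odd n\<close> \<open>coprime n p\<close> n4
    by (intro jacobi_reciprocity_1_mod_4) (auto simp: coprime_commute)
  also have "\<dots> = Legendre (int m) (int p)"
    using p(1) nm by (simp add: jacobi_prime Legendre_cong)
  finally show False using m(2) by simp
qed

section \<open>A pair of Pell-type equations\<close>

text \<open>
  When \<open>D - E\<close> is \<open>1\<close> or \<open>-1\<close>, the pairs \<open>(u, v)\<close> are the coefficients in
  \<open>u * sqrt D + v * sqrt E = (sqrt D + sqrt E) ^ (2 * m + 1)\<close>: one step multiplies by
  \<open>(sqrt D + sqrt E)\<^sup>2 = D + E + 2 * sqrt (D * E)\<close>.
\<close>

fun pell_orbit :: "int \<Rightarrow> int \<Rightarrow> nat \<Rightarrow> int \<times> int" where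
  "pell_orbit D E 0 = (1, 1)"
| "pell_orbit D E (Suc m) =
    (let (u, v) = pell_orbit D E m in ((D + E) * u + 2 * E * v, (D + E) * v + 2 * D * u))"

lemma pell_orbit_growth:
  assumes "D \<ge> 1" "E \<ge> 1" "D + E \<ge> 3" "pell_orbit D E m = (u, v)"
  shows "u \<ge> 2 * int m + 1 \<and> v \<ge> 1 \<and> (m > 0 \<longrightarrow> u > 2 * int m + 1)"
  using assms(4)
proof (induction m arbitrary: u v)
  case (Suc m)
  obtain x y where xy: "pell_orbit D E m = (x, y)" by fastforce
  then have IH: "x \<ge> 2 * int m + 1" "y \<ge> 1" using Suc.IH by auto
  have uv: "u = (D + E) * x + 2 * E * y" "v = (D + E) * y + 2 * D * x" using Suc.prems xy by auto
  have "3 * x \<le> (D + E) * x" "1 * 1 \<le> E * y" "1 * y \<le> (D + E) * y" "0 \<le> D * x"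
    using IH assms by (intro mult_right_mono mult_mono mult_nonneg_nonneg; simp)+
  then have "u \<ge> 3 * x + 2" "v \<ge> 1" using uv \<open>y \<ge> 1\<close> by (linarith, linarith)
  then show ?case using IH by simp
qed simp

text \<open>The substitution is the inverse of one step of the orbit; it is a similarity of the form \<open>D * u\<^sup>2 - E * v\<^sup>2\<close> with factor \<open>(D - E)\<^sup>2\<close>.\<close>

lemma pell_step_eq:
  fixes D E u v :: int
  assumes "D * u\<^sup>2 - E * v\<^sup>2 = D - E" "(D - E)\<^sup>2 = 1"
  shows "D * ((D + E) * u - 2 * E * v)\<^sup>2 - E * ((D + E) * v - 2 * D * u)\<^sup>2 = D - E"
proof -
  have "D * ((D + E) * u - 2 * E * v)\<^sup>2 - E * ((D + E) * v - 2 * D * u)\<^sup>2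
      = (D - E)\<^sup>2 * (D * u\<^sup>2 - E * v\<^sup>2)"
    by (simp add: power2_eq_square algebra_simps)
  then show ?thesis using assms by simp
qed

text \<open>The claim means \<open>(D + E - 1) * u < 2 * E * v < (D + E + 1) * u\<close>, that is, \<open>E * v\<close> lies strictly
  between \<open>E * u\<close> and \<open>D * u\<close>; squaring and using the equation shows both bounds.\<close>

lemma pell_step_less:
  fixes D E u v :: int
  assumes eq: "D * u\<^sup>2 - E * v\<^sup>2 = D - E" and DE: "D = E + 1 \<or> E = D + 1" "D \<ge> 1" "E \<ge> 1"
    and "u > 1" "v \<ge> 0"
  shows "\<bar>(D + E) * u - 2 * E * v\<bar> < u"
proof -
  have u2: "u\<^sup>2 > 1" using \<open>u > 1\<close> by (simp add: power_strict_increasing one_less_power)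
  show ?thesis
    using DE(1)
  proof
    assume D: "D = E + 1"
    have e: "E * v\<^sup>2 = E * u\<^sup>2 + u\<^sup>2 - 1" using eq D by (simp add: algebra_simps)
    then have "E * u\<^sup>2 < E * v\<^sup>2" using u2 by linarith
    then have "u\<^sup>2 < v\<^sup>2" using DE(3) by (simp add: mult_less_cancel_left)
    then have "u < v" using \<open>v \<ge> 0\<close> by (rule power2_less_imp_less)
    then have 1: "E * u < E * v" using DE by simp
    have "(E * v)\<^sup>2 = E * (E * v\<^sup>2)" by (simp add: power2_eq_square)
    also have "\<dots> = E\<^sup>2 * u\<^sup>2 + E * u\<^sup>2 - E" unfolding e by (simp add: power2_eq_square algebra_simps)
    also have "\<dots> < ((E + 1) * u)\<^sup>2"
    proof -
      have "((E + 1) * u)\<^sup>2 = E\<^sup>2 * u\<^sup>2 + E * u\<^sup>2 + E * u\<^sup>2 + u\<^sup>2"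
        by (simp add: power2_eq_square algebra_simps)
      moreover have "E * u\<^sup>2 > 0" using DE u2 by (intro mult_pos_pos) linarith+
      ultimately show ?thesis using u2 DE by linarith
    qed
    finally have 2: "E * v < (E + 1) * u" by (rule power2_less_imp_less) (use DE \<open>u > 1\<close> in simp)
    show ?thesis using 1 2 by (simp add: D algebra_simps abs_less_iff)
  next
    assume D: "E = D + 1"
    have e: "E * v\<^sup>2 = E * u\<^sup>2 - u\<^sup>2 + 1" using eq D by (simp add: algebra_simps)
    then have "E * v\<^sup>2 < E * u\<^sup>2" using u2 by linarith
    then have "v\<^sup>2 < u\<^sup>2" using DE(3) by (simp add: mult_less_cancel_left)
    then have "v < u" by (rule power2_less_imp_less) (use \<open>u > 1\<close> in simp)
    then have 1: "E * v < E * u" using DE by simp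
    have "(D * u)\<^sup>2 < (E * v)\<^sup>2"
    proof -
      have "(E * v)\<^sup>2 = E * (E * v\<^sup>2)" by (simp add: power2_eq_square)
      also have "\<dots> = (D * u)\<^sup>2 + D * u\<^sup>2 + D + 1" unfolding e by (simp add: D power2_eq_square algebra_simps)
      finally have "(E * v)\<^sup>2 = (D * u)\<^sup>2 + D * u\<^sup>2 + D + 1" .
      moreover have "D * u\<^sup>2 \<ge> 0" using DE by simp
      ultimately show ?thesis using DE by linarith
    qed
    then have 2: "D * u < E * v" by (rule power2_less_imp_less) (use DE \<open>v \<ge> 0\<close> in simp)
    show ?thesis using 1 2 by (simp add: D algebra_simps abs_less_iff)
  qed
qed

text \<open>Descent on \<open>\<bar>u\<bar>\<close>: the inverse step leads to a smaller solution, which lies on the orbit up to signs.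
  If its coordinates have equal signs, stepping forward again moves up the orbit; if the signs differ,
  it moves down the orbit, or stays at its origin, which contradicts that \<open>\<bar>u\<bar>\<close> is the larger one.\<close>

lemma pell_complete:
  fixes D E u v :: int
  assumes eq: "D * u\<^sup>2 - E * v\<^sup>2 = D - E" and DE: "D = E + 1 \<or> E = D + 1" "D \<ge> 1" "E \<ge> 1" "D + E > 3"
  shows "\<exists>m. pell_orbit D E m = (\<bar>u\<bar>, \<bar>v\<bar>)"
  using eq
proof (induction "nat \<bar>u\<bar>" arbitrary: u v rule: less_induct)
  case less
  define x y where "x = \<bar>u\<bar>" and "y = \<bar>v\<bar>"
  have xy: "D * x\<^sup>2 - E * y\<^sup>2 = D - E" "x \<ge> 0" "y \<ge> 0" using less.prems by (simp_all add: x_def y_def)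
  have DE2: "(D - E)\<^sup>2 = 1" using DE by auto
  consider "x = 0" | "x = 1" | "x > 1" using xy by linarith
  then have "\<exists>m. pell_orbit D E m = (x, y)"
  proof cases
    case 1
    then have "E * y\<^sup>2 = E - D" using xy by simp
    moreover from this have "E dvd E - D" by (metis dvd_triv_left)
    then have "E dvd 1" using DE by auto
    ultimately show ?thesis using DE by auto
  next
    case 2
    then have "y\<^sup>2 = 1" using xy DE by auto
    then have "y = 1" using xy by (simp add: power2_eq_1_iff)
    then have "pell_orbit D E 0 = (x, y)" using 2 by simp
    then show ?thesis by blast
  next
    case 3
    define x' y' where "x' = (D + E) * x - 2 * E * y" and "y' = (D + E) * y - 2 * D * x"
    have "\<bar>x'\<bar> < x" unfolding x'_def using pell_step_less[OF xy(1) DE(1-3) 3 xy(3)] .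
    then have "nat \<bar>x'\<bar> < nat \<bar>u\<bar>" by (simp add: x_def)
    moreover have "D * x'\<^sup>2 - E * y'\<^sup>2 = D - E"
      unfolding x'_def y'_def by (rule pell_step_eq[OF xy(1) DE2])
    ultimately obtain m where m: "pell_orbit D E m = (\<bar>x'\<bar>, \<bar>y'\<bar>)" using less.hyps by blast
    have step: "x = (D + E) * x' + 2 * E * y'" "y = (D + E) * y' + 2 * D * x'"
    proof -
      have "(D + E) * x' + 2 * E * y' = (D - E)\<^sup>2 * x" "(D + E) * y' + 2 * D * x' = (D - E)\<^sup>2 * y"
        by (simp_all add: x'_def y'_def power2_eq_square algebra_simps)
      then show "x = (D + E) * x' + 2 * E * y'" "y = (D + E) * y' + 2 * D * x'" using DE2 by simp_all
    qed
    have same: ?thesis if "x = s * ((D + E) * \<bar>x'\<bar> + 2 * E * \<bar>y'\<bar>)" "y = s * ((D + E) * \<bar>y'\<bar> + 2 * D * \<bar>x'\<bar>)" "s = 1 \<or> s = -1" for s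
    proof -
      have "pell_orbit D E (Suc m) = ((D + E) * \<bar>x'\<bar> + 2 * E * \<bar>y'\<bar>, (D + E) * \<bar>y'\<bar> + 2 * D * \<bar>x'\<bar>)"
        using m by simp
      then have "\<exists>m. pell_orbit D E m = ((D + E) * \<bar>x'\<bar> + 2 * E * \<bar>y'\<bar>, (D + E) * \<bar>y'\<bar> + 2 * D * \<bar>x'\<bar>)" ..
      moreover have "s = 1"
      proof (rule ccontr)
        assume "s \<noteq> 1"
        then have "x = - ((D + E) * \<bar>x'\<bar> + 2 * E * \<bar>y'\<bar>)" using that by simp
        moreover have "(D + E) * \<bar>x'\<bar> \<ge> 0" "E * \<bar>y'\<bar> \<ge> 0" using DE by simp_all
        ultimately show False using 3 by linarith
      qed
      ultimately show ?thesis using that by auto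
    qed
    have opp: ?thesis if "x = s * ((D + E) * \<bar>x'\<bar> - 2 * E * \<bar>y'\<bar>)" "y = s * (2 * D * \<bar>x'\<bar> - (D + E) * \<bar>y'\<bar>)" "s = 1 \<or> s = -1" for s
    proof (cases m)
      case 0
      then have "\<bar>x'\<bar> = 1" "\<bar>y'\<bar> = 1" using m by auto
      then have "x = s * (D - E)" using that by simp
      then have "\<bar>x\<bar> \<le> 1" using that(3) DE(1) by auto
      then show ?thesis using 3 by simp
    next
      case (Suc l)
      obtain a b where ab: "pell_orbit D E l = (a, b)" by fastforce
      then have "\<bar>x'\<bar> = (D + E) * a + 2 * E * b" "\<bar>y'\<bar> = (D + E) * b + 2 * D * a"
        using m Suc by auto
      then have "(D + E) * \<bar>x'\<bar> - 2 * E * \<bar>y'\<bar> = (D - E)\<^sup>2 * a"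
         "2 * D * \<bar>x'\<bar> - (D + E) * \<bar>y'\<bar> = - ((D - E)\<^sup>2 * b)"
        by (simp_all add: power2_eq_square algebra_simps)
      then have "x = s * a" "y = - (s * b)" using that DE2 by simp_all
      moreover have "a \<ge> 1" "b \<ge> 1" using pell_orbit_growth[OF _ _ _ ab] DE by auto
      ultimately have False using that(3) xy 3 by auto
      then show ?thesis ..
    qed
    consider "x' \<ge> 0" "y' \<ge> 0" | "x' \<ge> 0" "y' < 0" | "x' < 0" "y' \<ge> 0" | "x' < 0" "y' < 0" by linarith
    then show ?thesis
    proof cases
      case 1
      then have "\<bar>x'\<bar> = x'" "\<bar>y'\<bar> = y'" by simp_all
      then show ?thesis by (intro same[of 1]; (subst step(1) | subst step(2))?; simp add: algebra_simps)
    next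
      case 2
      then have "\<bar>x'\<bar> = x'" "\<bar>y'\<bar> = - y'" by simp_all
      then show ?thesis by (intro opp[of 1]; (subst step(1) | subst step(2))?; simp add: algebra_simps)
    next
      case 3
      then have "\<bar>x'\<bar> = - x'" "\<bar>y'\<bar> = y'" by simp_all
      then show ?thesis by (intro opp[of "-1"]; (subst step(1) | subst step(2))?; simp add: algebra_simps)
    next
      case 4
      then have "\<bar>x'\<bar> = - x'" "\<bar>y'\<bar> = - y'" by simp_all
      then have "x = -1 * ((D + E) * \<bar>x'\<bar> + 2 * E * \<bar>y'\<bar>)"
        "y = -1 * ((D + E) * \<bar>y'\<bar> + 2 * D * \<bar>x'\<bar>)"
        by (subst step, simp add: algebra_simps)+
      then show ?thesis by (rule same) simp
    qed
  qed
  then show ?case by (simp add: x_def y_def)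
qed

section \<open>Valuations of Chebyshev polynomials\<close>

text \<open>
  Up to the sign \<open>(-1) ^ m\<close>, \<open>cheb m (- 4 * x\<^sup>2)\<close> is \<open>T (2 * m + 1) x / x\<close> for the Chebyshev polynomial
  \<open>T (2 * m + 1)\<close> of the first kind. The coefficient is \<open>(2 * m + 1) / (2 * i + 1)\<close> times \<open>m + i\<close> choose
  \<open>2 * i\<close>, written here as a sum of binomials so that it is visibly an integer and Pascal's rule
  yields its recurrence.
\<close>

definition cheb_coeff :: "nat \<Rightarrow> nat \<Rightarrow> nat"
  where "cheb_coeff m i = (Suc (m + i) choose (2 * i + 1)) + ((m + i) choose (2 * i + 1))"

definition cheb :: "nat \<Rightarrow> int \<Rightarrow> int"
  where "cheb m z = (\<Sum>i\<le>m. int (cheb_coeff m i) * z ^ i)"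

lemma cheb_coeff_0 [simp]: "cheb_coeff m 0 = 2 * m + 1"
  by (simp add: cheb_coeff_def)

lemma cheb_coeff_eq_0: "i > m \<Longrightarrow> cheb_coeff m i = 0"
  by (simp add: cheb_coeff_def binomial_eq_0)

lemma cheb_coeff_rec:
  "cheb_coeff (Suc (Suc m)) (Suc i) + cheb_coeff m (Suc i) =
     2 * cheb_coeff (Suc m) (Suc i) + cheb_coeff (Suc m) i"
  by (simp add: cheb_coeff_def numeral_2_eq_2)

lemma cheb_coeff_mult: "(2 * i + 1) * cheb_coeff m i = (2 * m + 1) * ((m + i) choose (2 * i))"
proof (cases "i \<le> m")
  case True
  have "(2 * i + 1) * (Suc (m + i) choose (2 * i + 1)) = Suc (m + i) * ((m + i) choose (2 * i))"
    using Suc_times_binomial_eq[of "m + i" "2 * i"] by (simp add: mult.commute)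
  moreover have "(2 * i + 1) * ((m + i) choose (2 * i + 1)) = (m - i) * ((m + i) choose (2 * i))"
    using binomial_absorb_comp[of "m + i" "2 * i"] binomial_absorption[of "2 * i" "m + i"] by simp
  moreover have "Suc (m + i) + (m - i) = 2 * m + 1" using True by simp
  ultimately show ?thesis unfolding cheb_coeff_def by (metis add_mult_distrib add_mult_distrib2)
qed (simp add: cheb_coeff_eq_0 binomial_eq_0)

text \<open>A common upper limit of summation lets the recurrence be checked coefficientwise.\<close>

lemma cheb_sum_extend:
  assumes "K \<ge> m"
  shows "cheb m z = (\<Sum>i\<le>K. int (cheb_coeff m i) * z ^ i)"
  unfolding cheb_def using assms
  by (intro sum.mono_neutral_left) (auto simp: cheb_coeff_eq_0)

lemma cheb_0: "cheb 0 z = 1"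
  by (simp add: cheb_def)

lemma cheb_1: "cheb (Suc 0) z = 3 + z"
  by (simp add: cheb_def cheb_coeff_def eval_nat_numeral)

lemma cheb_rec: "cheb (Suc (Suc m)) z = (2 + z) * cheb (Suc m) z - cheb m z"
proof -
  let ?c = "\<lambda>m i. int (cheb_coeff m i)"
  let ?K = "Suc m"
  have S: "cheb n z = ?c n 0 + (\<Sum>i\<le>?K. ?c n (Suc i) * z ^ Suc i)" if "n \<le> Suc (Suc m)" for n
  proof -
    have "cheb n z = (\<Sum>i\<le>Suc ?K. ?c n i * z ^ i)" by (rule cheb_sum_extend[OF that])
    also have "\<dots> = ?c n 0 * z ^ 0 + (\<Sum>i\<le>?K. ?c n (Suc i) * z ^ Suc i)"
      by (rule sum.atMost_Suc_shift)
    finally show ?thesis by simp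
  qed
  have c: "?c (Suc (Suc m)) (Suc i) = 2 * ?c (Suc m) (Suc i) + ?c (Suc m) i - ?c m (Suc i)" for i
    using cheb_coeff_rec[of m i] by linarith
  have "cheb (Suc (Suc m)) z = ?c (Suc (Suc m)) 0 + (\<Sum>i\<le>?K. ?c (Suc (Suc m)) (Suc i) * z ^ Suc i)"
    by (rule S) simp
  also have "(\<Sum>i\<le>?K. ?c (Suc (Suc m)) (Suc i) * z ^ Suc i) =
     2 * (\<Sum>i\<le>?K. ?c (Suc m) (Suc i) * z ^ Suc i) + z * (\<Sum>i\<le>?K. ?c (Suc m) i * z ^ i)
      - (\<Sum>i\<le>?K. ?c m (Suc i) * z ^ Suc i)"
    unfolding sum_distrib_left sum.distrib[symmetric] sum_subtractf[symmetric] c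
    by (intro sum.cong refl) (simp add: algebra_simps)
  also have "(\<Sum>i\<le>?K. ?c (Suc m) i * z ^ i) = cheb (Suc m) z"
    by (simp add: cheb_def)
  also have "(\<Sum>i\<le>?K. ?c (Suc m) (Suc i) * z ^ Suc i) = cheb (Suc m) z - ?c (Suc m) 0"
    using S[of "Suc m"] by simp
  also have "(\<Sum>i\<le>?K. ?c m (Suc i) * z ^ Suc i) = cheb m z - ?c m 0"
    using S[of m] by simp
  finally show ?thesis by (simp add: algebra_simps)
qed

text \<open>Both sides satisfy the recurrence with characteristic polynomial \<open>x\<^sup>2 - 2 * (D + E) * x + 1\<close>.
  The factor \<open>(E - D) ^ m\<close> treats the two signs of \<open>D - E\<close> uniformly.\<close>

lemma pell_orbit_cheb:
  assumes "(D - E)\<^sup>2 = 1"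
  shows "fst (pell_orbit D E m) = (E - D) ^ m * cheb m (4 * D * (E - D))"
proof (induction m rule: induct_nat_012)
  case (ge2 m)
  obtain u v where uv: "pell_orbit D E m = (u, v)" by fastforce
  let ?d = "E - D"
  have d: "?d * ?d = 1" using assms by (simp add: power2_eq_square algebra_simps)
  have "fst (pell_orbit D E (Suc (Suc m))) = 2 * (D + E) * fst (pell_orbit D E (Suc m)) - (?d * ?d) * u"
    using uv by (simp add: algebra_simps)
  also have "\<dots> = 2 * (D + E) * (?d ^ Suc m * cheb (Suc m) (4 * D * ?d)) - ?d ^ m * cheb m (4 * D * ?d)"
    using ge2 uv d by simp
  also have "2 * (D + E) * (?d ^ Suc m * cheb (Suc m) (4 * D * ?d))
      = ?d ^ m * ((2 * (?d * ?d) + 4 * D * ?d) * cheb (Suc m) (4 * D * ?d))"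
    by (simp add: algebra_simps)
  also have "\<dots> - ?d ^ m * cheb m (4 * D * ?d) = ?d ^ m * cheb (Suc (Suc m)) (4 * D * ?d)"
    unfolding d cheb_rec by (simp add: algebra_simps)
  also have "\<dots> = ?d ^ Suc (Suc m) * cheb (Suc (Suc m)) (4 * D * ?d)"
    using d by (simp add: mult.assoc[symmetric])
  finally show ?case .
next
  case 1
  have "D + 3 * E = (E - D) * 3 + 4 * D * 1" by simp
  also have "1 = (E - D) * (E - D)" using assms by (simp add: power2_eq_square algebra_simps)
  finally show ?case by (simp add: cheb_1 algebra_simps)
qed (simp add: cheb_0)

text \<open>The constant coefficient is \<open>2 * m + 1\<close>. By \<open>cheb_coeff_mult\<close> the \<open>i\<close>-th coefficient loses at most the
  valuation of \<open>2 * i + 1\<close> against \<open>2 * m + 1\<close>; that is less than \<open>i\<close>, because \<open>2 * i + 1 < 5 ^ i\<close>, and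
  \<open>z ^ i\<close> makes up for it. So all other terms have larger valuation than the constant one.\<close>

lemma prime_power_not_dvd_cheb:
  fixes q :: nat
  assumes q: "prime q" "q \<ge> 5" and z: "int q dvd z"
  shows "\<not> int q ^ Suc (multiplicity q (2 * m + 1)) dvd cheb m z"
proof
  define e where "e = multiplicity q (2 * m + 1)"
  assume "int q ^ Suc (multiplicity q (2 * m + 1)) dvd cheb m z"
  then have dvd: "int q ^ Suc e dvd cheb m z" by (simp add: e_def)
  have "int q ^ Suc e dvd int (cheb_coeff m i) * z ^ i" if "i > 0" "i \<le> m" for i
  proof -
    define f where "f = multiplicity q (2 * i + 1)"
    have "q ^ f \<le> 2 * i + 1" unfolding f_def by (intro dvd_imp_le multiplicity_dvd) auto
    also have "2 * i + 1 < 5 ^ i" using that(1)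
    proof (induction i)
      case (Suc i) then show ?case by (cases "i = 0") auto
    qed simp
    also have "5 ^ i \<le> q ^ i" using q(2) by (rule power_mono) simp
    finally have "f < i" using q(2) by (simp add: power_strict_increasing_iff)
    have c: "cheb_coeff m i > 0" using that by (simp add: cheb_coeff_def)
    have "q ^ e dvd (2 * i + 1) * cheb_coeff m i"
      unfolding cheb_coeff_mult e_def by (intro dvd_mult2 multiplicity_dvd)
    then have "e \<le> multiplicity q ((2 * i + 1) * cheb_coeff m i)"
      using c q by (intro multiplicity_geI) auto
    also have "\<dots> = f + multiplicity q (cheb_coeff m i)"
      unfolding f_def using c q by (intro prime_elem_multiplicity_mult_distrib) auto
    finally have "Suc e \<le> multiplicity q (cheb_coeff m i) + i" using \<open>f < i\<close> by simp
    then have "int q ^ Suc e dvd int q ^ multiplicity q (cheb_coeff m i) * int q ^ i"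
      by (simp only: power_add[symmetric] le_imp_power_dvd)
    also have "\<dots> dvd int (cheb_coeff m i) * z ^ i"
      using multiplicity_dvd[of q "cheb_coeff m i"] z by (intro mult_dvd_mono dvd_power_same) (simp_all flip: of_nat_power)
    finally show ?thesis .
  qed
  then have "int q ^ Suc e dvd (\<Sum>i\<in>{1..m}. int (cheb_coeff m i) * z ^ i)"
    by (intro dvd_sum) auto
  moreover have "cheb m z = int (2 * m + 1) + (\<Sum>i\<in>{1..m}. int (cheb_coeff m i) * z ^ i)"
    unfolding cheb_def atMost_atLeast0 by (subst sum.atLeast_Suc_atMost) simp_all
  ultimately have "int q ^ Suc e dvd int (2 * m + 1)" using dvd by (metis dvd_add_left_iff)
  then have "q ^ Suc e dvd 2 * m + 1" by (metis of_nat_dvd_iff of_nat_power)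
  then have "Suc e \<le> e" unfolding e_def using q by (intro multiplicity_geI) auto
  then show False by simp
qed

text \<open>On the orbit at index \<open>m\<close> the valuation bound gives \<open>u \<le> 2 * m + 1\<close> when \<open>u\<close> is a power of \<open>q\<close>, and
  growth of the orbit excludes this unless \<open>m = 0\<close>, where \<open>u = 1\<close>.\<close>

lemma pell_prime_power_solution:
  fixes q :: nat and D E u v :: int
  assumes q: "prime q" "q \<ge> 5" "int q dvd D" and DE: "D = E + 1 \<or> E = D + 1" "D \<ge> 1" "E \<ge> 1"
    and eq: "D * u\<^sup>2 - E * v\<^sup>2 = D - E" and u: "u = int q ^ i"
  shows "i = 0"
proof -
  have "D \<ge> 5" using zdvd_imp_le[OF q(3)] q(2) DE(2) by linarith
  then have "D + E > 3" using DE by linarith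
  then obtain m where m: "pell_orbit D E m = (\<bar>u\<bar>, \<bar>v\<bar>)" using pell_complete[OF eq DE] by blast
  have "u > 0" using u q by simp
  have DE2: "(D - E)\<^sup>2 = 1" using DE by auto
  have "u = (E - D) ^ m * cheb m (4 * D * (E - D))"
    using pell_orbit_cheb[OF DE2, of m] m \<open>u > 0\<close> by simp
  then have "u dvd cheb m (4 * D * (E - D)) * ((E - D) ^ m)" by simp
  moreover have "is_unit ((E - D) ^ m)" using DE(1) by auto
  ultimately have "int q ^ i dvd cheb m (4 * D * (E - D))"
    using dvd_mult_unit_iff[of "(E - D) ^ m"] u by metis
  moreover have "\<not> int q ^ Suc (multiplicity q (2 * m + 1)) dvd cheb m (4 * D * (E - D))"
    using prime_power_not_dvd_cheb[OF q(1,2)] q(3) by simp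
  ultimately have "\<not> Suc (multiplicity q (2 * m + 1)) \<le> i"
    using le_imp_power_dvd dvd_trans by blast
  then have "int q ^ i \<le> int (q ^ multiplicity q (2 * m + 1))"
    using q by (simp add: power_increasing)
  also have "\<dots> \<le> int (2 * m + 1)" unfolding of_nat_le_iff by (intro dvd_imp_le multiplicity_dvd) auto
  finally have "u \<le> 2 * int m + 1" using u by simp
  then have "m = 0"
    using pell_orbit_growth[OF DE(2,3) _ m] \<open>D + E > 3\<close> \<open>u > 0\<close> by fastforce
  then have "u = 1" using m \<open>u > 0\<close> by simp
  then show ?thesis using u q by simp
qed

section \<open>Squares among sums of prime powers\<close>

lemma coprime_mult_square_imp_square:
  fixes x y a b :: int
  assumes "x > 0" "y > 0" "coprime x y" "a \<noteq> 0" "x * y * a\<^sup>2 = b\<^sup>2"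
  shows "\<exists>c. x = c\<^sup>2"
proof -
  have "a\<^sup>2 dvd b\<^sup>2" by (metis assms(5) dvd_triv_right)
  then have "a dvd b" by simp
  then obtain c where "b = a * c" ..
  then have "x * y * a\<^sup>2 = c\<^sup>2 * a\<^sup>2" using assms(5) by (simp add: power_mult_distrib mult.commute)
  then have xy: "x * y = c\<^sup>2" using assms(4) by simp
  have "int (nat x * nat y) = int ((nat \<bar>c\<bar>)\<^sup>2)" using xy assms(1,2) by simp
  then have "nat x * nat y = (nat \<bar>c\<bar>)\<^sup>2" by (simp only: of_nat_eq_iff)
  moreover have "coprime (nat x) (nat y)"
    using coprime_int_iff[of "nat x" "nat y"] assms(1-3) by simp
  ultimately have "is_nth_power 2 (nat x)"
    using is_nth_power_mult_coprime_natD(1)[of "nat x" "nat y" 2] assms(1,2) by auto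
  then obtain d where "nat x = d\<^sup>2" by (auto elim: is_nth_powerE)
  then have "x = (int d)\<^sup>2" using assms(1) by (metis int_nat_eq of_nat_power less_imp_le)
  then show ?thesis ..
qed

text \<open>A prime \<open>l\<close> divides at most one of the coprime numbers \<open>A\<close>, \<open>B\<close>, so the other one has even valuations only.\<close>

lemma coprime_mult_eq_prime_times_square:
  fixes A B a b l :: int
  assumes "A > 0" "B > 0" "coprime A B" "l = 1 \<or> prime l" "a \<noteq> 0" "A * B * a\<^sup>2 = l * b\<^sup>2"
  shows "(\<exists>c. A = c\<^sup>2) \<or> (\<exists>c. B = c\<^sup>2)"
proof -
  have l: "l > 0" using assms(4) prime_gt_0_int by auto
  have *: "\<exists>c. x = c\<^sup>2" if "x > 0" "y > 0" "coprime x y" "coprime x l" "x * y * a\<^sup>2 = l * b\<^sup>2" for x y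
  proof (rule coprime_mult_square_imp_square)
    show "x * (y * l) * a\<^sup>2 = (l * b)\<^sup>2"
      using that(5) by (simp add: power2_eq_square ac_simps)
  qed (use that l assms(5) in simp_all)
  have "coprime A l \<or> coprime B l"
  proof (cases "l dvd A \<and> l \<noteq> 1")
    case True
    then have "\<not> l dvd B" using assms(3,4) coprime_common_divisor not_prime_unit by metis
    then show ?thesis using True assms(4) prime_imp_coprime coprime_commute by blast
  next
    case False
    then show ?thesis using assms(4) prime_imp_coprime[of l A] by (auto simp: coprime_commute)
  qed
  then show ?thesis
  proof
    assume "coprime A l"
    then have "\<exists>c. A = c\<^sup>2" using *[of A B] assms by blast
    then show ?thesis ..
  next
    assume "coprime B l"
    then have "\<exists>c. B = c\<^sup>2" using *[of B A] assms by (simp add: coprime_commute mult.commute[of B])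
    then show ?thesis ..
  qed
qed

text \<open>A square \<open>y\<^sup>2\<close> would solve the Pell-type equation with \<open>D = q\<close>, \<open>E = q - 1\<close> and a power of \<open>q\<close> as
  first coordinate.\<close>

lemma geometric_sum_not_square:
  fixes q r :: nat
  assumes "prime q" "q \<ge> 5" "odd r" "r > 1"
  shows "(\<Sum>i<r. int q ^ i) \<noteq> y\<^sup>2"
proof
  assume y: "(\<Sum>i<r. int q ^ i) = y\<^sup>2"
  define j where "j = r div 2"
  have r: "r = Suc (2 * j)" using assms(3) by (simp add: j_def)
  have "(1 - int q) * y\<^sup>2 = 1 - int q ^ r" using one_diff_power_eq[of "int q" r] y by simp
  moreover have "int q * (int q ^ j)\<^sup>2 = int q ^ r" by (simp add: r power_mult[symmetric] mult.commute)
  ultimately have "int q * (int q ^ j)\<^sup>2 - (int q - 1) * y\<^sup>2 = int q - (int q - 1)"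
    by (simp add: algebra_simps)
  then have "j = 0"
    using pell_prime_power_solution[OF assms(1,2), of "int q" "int q - 1" "int q ^ j" y j] assms(2) by simp
  then show False using r assms(4) by simp
qed

text \<open>The condition modulo \<open>4\<close> matters: \<open>23 ^ 3 + 1 = 2 * 78\<^sup>2\<close>. It enters through the Jacobi symbols, in
  the case that the two factors of \<open>y\<^sup>2\<close> have a common divisor.\<close>

lemma prime_power_plus_one_not_twice_square:
  fixes q r :: nat
  assumes "prime q" "[q = 1] (mod 4)" "odd r" "r > 1"
  shows "int q ^ r + 1 \<noteq> 2 * y\<^sup>2"
proof
  assume y: "int q ^ r + 1 = 2 * y\<^sup>2"
  obtain p where p: "prime p" "p dvd r" using prime_factor_nat[of r] assms(4) by auto
  then obtain s where r: "r = p * s" by (elim dvdE)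
  have "odd p" using assms(3) r by simp
  then have "p > 2" using p(1) prime_ge_2_nat[of p] by (cases "p = 2") auto
  have "s > 0" using r assms(4) by (intro Nat.gr0I) simp
  define X where "X = int q ^ s"
  have "q > 1" using prime_gt_1_nat[OF assms(1)] .
  have "q mod 4 = 1" using assms(2) by (simp add: cong_def)
  then have "q \<ge> 5" using \<open>q > 1\<close> by presburger
  have "X > 0" using \<open>q > 1\<close> by (simp add: X_def)
  have "[int q = int 1] (mod int 4)" using assms(2) by (simp only: cong_int_iff)
  then have "[X = 1 ^ s] (mod 4)" unfolding X_def by (intro cong_pow) simp
  then have X4: "[X = 1] (mod 4)" by simp
  define c L where "c = (X + 1) div 2" and "L = alt_sum X p"
  have "X mod 4 = 1" using X4 by (simp add: cong_def)
  then have c: "X + 1 = 2 * c" unfolding c_def by presburger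
  then have "c > 0" using \<open>X > 0\<close> by linarith
  have "L > 0" using alt_sum_pos[OF \<open>X > 0\<close> \<open>odd p\<close>] by (simp add: L_def)
  have XL: "(X + 1) * L = 1 + X ^ p" using alt_sum_mult[of X p] \<open>odd p\<close> by (simp add: L_def)
  have Xp: "X ^ p = int q ^ r" by (simp add: X_def r power_mult[symmetric] mult.commute)
  have cL: "c * L = y\<^sup>2" using XL Xp y c by simp
  have dvd_X: "[X = -1] (mod d)" if "d dvd c" for d
    using that c by (simp add: cong_iff_dvd_diff)
  have "[L = int p] (mod gcd c L)" unfolding L_def by (rule alt_sum_cong, rule dvd_X) simp
  then have "gcd c L dvd int p" using cong_dvd_iff[of L "int p" "gcd c L"] by simp
  then have "gcd c L = 1 \<or> gcd c L = int p"
    using prime_int_iff[of "int p"] p(1) by auto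
  then show False
  proof
    assume "gcd c L = 1"
    then have "coprime L c" by (simp add: coprime_iff_gcd_eq_1[symmetric] gcd.commute coprime_commute)
    then obtain b where b: "L = b\<^sup>2"
      using coprime_mult_square_imp_square[of L c 1 y] cL \<open>c > 0\<close> \<open>L > 0\<close> by (auto simp: mult.commute)
    define j where "j = p div 2"
    have pj: "p = Suc (2 * j)" using \<open>odd p\<close> by (simp add: j_def)
    have "X * (X ^ j)\<^sup>2 = X ^ p" by (simp add: pj power_mult[symmetric] mult.commute)
    then have "X * (X ^ j)\<^sup>2 - (X + 1) * b\<^sup>2 = X - (X + 1)" using XL b by simp
    moreover have "int q dvd X" using \<open>s > 0\<close> by (simp add: X_def)
    moreover have "X ^ j = int q ^ (s * j)" by (simp add: X_def power_mult)
    ultimately have "s * j = 0"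
      using pell_prime_power_solution[OF assms(1) \<open>q \<ge> 5\<close>, of X "X + 1" "X ^ j" b "s * j"] \<open>X > 0\<close> by simp
    then show False using \<open>s > 0\<close> pj \<open>p > 2\<close> by simp
  next
    \<comment> \<open>Dividing both factors by \<open>p\<close> leaves coprime numbers whose product is still a square.\<close>
    assume g: "gcd c L = int p"
    then have pc: "int p dvd c" "int p dvd L" by (metis gcd_dvd1, metis gcd_dvd2)
    then obtain c' L' where c': "c = int p * c'" and L': "L = int p * L'" by (elim dvdE)
    have "p > 0" using \<open>p > 2\<close> by simp
    have "int p * gcd c' L' = int p" using g unfolding c' L' by (simp add: gcd_mult_left)
    then have "gcd L' c' = 1" using \<open>p > 0\<close> by (simp add: gcd.commute)
    then have "coprime L' c'" by (simp only: coprime_iff_gcd_eq_1)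
    moreover have "c' > 0" "L' > 0"
      using \<open>c > 0\<close> \<open>L > 0\<close> \<open>p > 0\<close> unfolding c' L' by (simp_all add: zero_less_mult_iff)
    moreover have "L' * c' * (int p)\<^sup>2 = y\<^sup>2" using cL by (simp add: c' L' power2_eq_square ac_simps)
    ultimately obtain b where "L' = b\<^sup>2"
      using coprime_mult_square_imp_square[of L' c' "int p" y] \<open>p > 0\<close> by auto
    then have "alt_sum X p = int p * b\<^sup>2" using L' by (simp add: L_def)
    then show False
      using alt_sum_ne_prime_times_square[OF \<open>X > 0\<close> X4 p(1) \<open>p > 2\<close> dvd_X[OF pc(1)]] by simp
  qed
qed

section \<open>The divisor sum\<close>

lemma finite_divisors: "m \<noteq> 0 \<Longrightarrow> finite {d :: int. 0 < d \<and> d dvd m}"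
  by (rule finite_subset[of _ "{-\<bar>m\<bar>..\<bar>m\<bar>}"]) (use dvd_imp_le_int[of m] in fastforce)+

text \<open>Divisors of \<open>a * b\<close> correspond to pairs of divisors, the inverse of multiplication being \<open>d \<mapsto> (gcd d a, gcd d b)\<close>.\<close>

lemma sigma_mult:
  fixes a b :: int
  assumes "a > 0" "b > 0" "coprime a b"
  shows "sigma (a * b) = sigma a * sigma b"
proof -
  let ?D = "\<lambda>m :: int. {d. 0 < d \<and> d dvd m}"
  have gcds: "gcd (d * e) a = d" "gcd (d * e) b = e" if "d > 0" "e > 0" "d dvd a" "e dvd b" for d e
  proof -
    have "coprime a e" using coprime_divisors[OF dvd_refl that(4) assms(3)] .
    then show "gcd (d * e) a = d" using that by (simp add: gcd_mult_left_right_cancel)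
    have "coprime b d"
      using coprime_divisors[OF that(3) dvd_refl assms(3)] by (simp add: coprime_commute)
    then show "gcd (d * e) b = e" using that by (simp add: gcd_mult_left_left_cancel)
  qed
  have "sigma a * sigma b = (\<Sum>(d, e)\<in>?D a \<times> ?D b. d * e)"
    unfolding sigma_def sum_product sum.cartesian_product ..
  also have "\<dots> = (\<Sum>d\<in>?D (a * b). d)"
  proof (rule sum.reindex_bij_witness[of _ "\<lambda>d. (gcd d a, gcd d b)" "\<lambda>(d, e). d * e"])
    fix x assume "x \<in> ?D a \<times> ?D b"
    then obtain d e where x: "x = (d, e)" "d > 0" "e > 0" "d dvd a" "e dvd b" by auto
    show "(\<lambda>d. (gcd d a, gcd d b)) ((\<lambda>(d, e). d * e) x) = x" using gcds[OF x(2-5)] x(1) by simp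
    show "(\<lambda>(d, e). d * e) x \<in> ?D (a * b)" using x by (simp add: mult_dvd_mono)
    show "(\<lambda>(d, e). d * e) x = (case x of (d, e) \<Rightarrow> d * e)" ..
  next
    fix d assume "d \<in> ?D (a * b)"
    then have d: "d > 0" "d dvd a * b" by simp_all
    obtain u v where uv: "d = u * v" "u dvd a" "v dvd b" using division_decomp[OF d(2)] by blast
    then have "u \<noteq> 0" "v \<noteq> 0" using d(1) by auto
    have "d = \<bar>u\<bar> * \<bar>v\<bar>" using uv(1) d(1) by (simp add: abs_mult[symmetric])
    then have "gcd d a = \<bar>u\<bar>" "gcd d b = \<bar>v\<bar>"
      using gcds[of "\<bar>u\<bar>" "\<bar>v\<bar>"] uv(2,3) \<open>u \<noteq> 0\<close> \<open>v \<noteq> 0\<close> by simp_all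
    then show "(\<lambda>(d, e). d * e) (gcd d a, gcd d b) = d" using \<open>d = \<bar>u\<bar> * \<bar>v\<bar>\<close> by simp
    show "(gcd d a, gcd d b) \<in> ?D a \<times> ?D b" using assms by simp
  qed
  finally show ?thesis by (simp add: sigma_def)
qed

lemma sigma_prime_power:
  fixes p :: int
  assumes "prime p"
  shows "sigma (p ^ k) = (\<Sum>i\<le>k. p ^ i)"
proof -
  have p: "p > 1" using assms by (rule prime_gt_1_int)
  have "{d. 0 < d \<and> d dvd p ^ k} = (\<lambda>i. p ^ i) ` {..k}"
  proof (intro equalityI subsetI)
    fix d assume "d \<in> {d. 0 < d \<and> d dvd p ^ k}"
    then have d: "d > 0" "d dvd p ^ k" by auto
    obtain i where "i \<le> k" "normalize d = p ^ i" using divides_primepow[OF assms d(2)] .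
    then show "d \<in> (\<lambda>i. p ^ i) ` {..k}" using d p by auto
  qed (use p in \<open>auto simp: le_imp_power_dvd\<close>)
  moreover have "inj_on (\<lambda>i. p ^ i) {..k}" using p by (auto intro!: inj_onI simp: power_inject_exp)
  ultimately show ?thesis by (simp add: sigma_def sum.reindex)
qed

lemma sigma_ge:
  assumes "m > 0"
  shows "sigma m \<ge> m"
proof -
  have "(\<Sum>d\<in>{m}. d) \<le> sigma m"
    unfolding sigma_def using assms finite_divisors[of m] by (intro sum_mono2) auto
  then show ?thesis by simp
qed

text \<open>The geometric sum over \<open>2 * r\<close> terms splits as \<open>(q ^ r + 1) * B\<close>. Here \<open>A = (q ^ r + 1) / 2\<close> is odd
  because \<open>q \<equiv> 1\<close> modulo \<open>4\<close>, which makes \<open>A\<close> and \<open>B\<close> coprime.\<close>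

lemma sigma_prime_power_ne_twice_prime_times_square:
  fixes q a b l :: int
  assumes q: "prime q" "[q = 1] (mod 4)" and \<alpha>: "[\<alpha> = 1] (mod 4)" "\<alpha> > 1"
    and l: "l = 1 \<or> prime l" and "a \<noteq> 0"
  shows "sigma (q ^ \<alpha>) * a\<^sup>2 \<noteq> 2 * l * b\<^sup>2"
proof
  assume eq: "sigma (q ^ \<alpha>) * a\<^sup>2 = 2 * l * b\<^sup>2"
  have "q > 1" using q(1) by (rule prime_gt_1_int)
  define t where "t = nat q"
  have t: "q = int t" "prime t"
    using \<open>q > 1\<close> iffD1[OF prime_int_nat_transfer q(1)] by (simp_all add: t_def)
  have "[t = 1] (mod 4)" using q(2) cong_int_iff[of t 1 4] t(1) by simp
  have "t mod 4 = 1" using \<open>[t = 1] (mod 4)\<close> by (simp add: cong_def)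
  then have "t \<ge> 5" using \<open>q > 1\<close> t(1) by presburger
  define r where "r = (\<alpha> + 1) div 2"
  have "\<alpha> mod 4 = 1" using \<alpha>(1) by (simp add: cong_def)
  then have "odd r" "r > 1" "\<alpha> + 1 = 2 * r" using \<alpha>(2) unfolding r_def by presburger+
  define A B where "A = (q ^ r + 1) div 2" and "B = (\<Sum>i<r. q ^ i)"
  have "[q ^ r = 1 ^ r] (mod 4)" using q(2) by (rule cong_pow)
  then have "q ^ r mod 4 = 1" by (simp add: cong_def)
  moreover have "odd (w div 2) \<and> w = 2 * (w div 2)" if "w = x + 1" "x mod 4 = 1" for w x :: int
    using that by presburger
  ultimately have A: "odd A" "q ^ r + 1 = 2 * A" unfolding A_def by blast+
  have B: "(q - 1) * B = q ^ r - 1"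
    using one_diff_power_eq[of q r] by (simp add: B_def algebra_simps)
  have "sigma (q ^ \<alpha>) = (\<Sum>i<r + r. q ^ i)"
  proof -
    have "{..\<alpha>} = {..<r + r}" using \<open>\<alpha> + 1 = 2 * r\<close> by auto
    then show ?thesis using sigma_prime_power[OF q(1), of \<alpha>] by simp
  qed
  also have "\<dots> = (q ^ r + 1) * B"
  proof -
    have "(1 - q) * (\<Sum>i<r + r. q ^ i) = 1 - q ^ r * q ^ r"
      using one_diff_power_eq[of q "r + r"] by (simp add: power_add)
    also have "\<dots> = - (q ^ r + 1) * ((q - 1) * B)" unfolding B by (simp add: algebra_simps)
    also have "\<dots> = (1 - q) * ((q ^ r + 1) * B)" by (simp add: algebra_simps)
    finally show ?thesis using \<open>q > 1\<close> by simp
  qed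
  finally have "sigma (q ^ \<alpha>) = 2 * (A * B)" using A(2) by simp
  then have AB: "A * B * a\<^sup>2 = l * b\<^sup>2" using eq by simp
  have "q ^ r > 1" using \<open>q > 1\<close> \<open>r > 1\<close> by (simp add: one_less_power)
  then have "A > 0" using A(2) by linarith
  have "(q - 1) * B > 0" using B \<open>q ^ r > 1\<close> by simp
  then have "B > 0" using \<open>q > 1\<close> by (simp add: zero_less_mult_iff)
  have "coprime A B"
  proof (rule coprimeI)
    fix d assume "d dvd A" "d dvd B"
    then have "d dvd 2 * A - (q - 1) * B" by simp
    also have "2 * A - (q - 1) * B = 2" using A(2) B by simp
    finally have "d dvd 2" .
    moreover have "coprime A 2" using \<open>odd A\<close> by simp
    ultimately show "is_unit d" using \<open>d dvd A\<close> coprime_common_divisor by blast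
  qed
  then consider c where "A = c\<^sup>2" | c where "B = c\<^sup>2"
    using coprime_mult_eq_prime_times_square[OF \<open>A > 0\<close> \<open>B > 0\<close> _ l \<open>a \<noteq> 0\<close> AB] by blast
  then show False
  proof cases
    case 1
    then show False
      using prime_power_plus_one_not_twice_square[OF t(2) \<open>[t = 1] (mod 4)\<close> \<open>odd r\<close> \<open>r > 1\<close>, of c] A(2) t(1)
      by simp
  next
    case 2
    then show False
      using geometric_sum_not_square[OF t(2) \<open>t \<ge> 5\<close> \<open>odd r\<close> \<open>r > 1\<close>, of c] t(1) by (simp add: B_def)
  qed
qed

text \<open>As \<open>q\<close> is prime, multiplicativity of \<open>sigma\<close> leaves room for one prime power only: \<open>n\<^sup>2 = p ^ e\<close> with
  \<open>p\<close> odd. With \<open>P = p ^ e\<close>, comparing \<open>(p - 1) * q = p * P - 1\<close> with \<open>q \<ge> 2 * P - 1\<close> yields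
  \<open>(p - 2) * (P - 1) \<le> 0\<close>.\<close>

lemma sigma_square_ne_multiple_minus_one:
  fixes n k q :: int
  assumes "odd n" "k \<ge> 2" "prime q" "sigma (n\<^sup>2) = q" "q + 1 = k * n\<^sup>2"
  shows False
proof -
  have "n \<noteq> 0" using assms(1) by auto
  have "\<bar>n\<bar> \<noteq> 1"
  proof
    assume "\<bar>n\<bar> = 1"
    then have "n\<^sup>2 = 1" using power2_abs[of n] by simp
    moreover have "sigma 1 = 1" using sigma_prime_power[of 2 0] by simp
    ultimately show False using assms(3,4) by auto
  qed
  then obtain p where p: "prime p" "p dvd n" using prime_factor_int by blast
  have "p \<ge> 3"
  proof -
    have "p \<noteq> 2" using p(2) assms(1) by auto
    then show ?thesis using prime_ge_2_int[OF p(1)] by simp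
  qed
  define e where "e = multiplicity p (n\<^sup>2)"
  have "n\<^sup>2 \<noteq> 0" "\<not> is_unit p" using \<open>n \<noteq> 0\<close> not_prime_unit p(1) by auto
  then obtain w where w: "n\<^sup>2 = p ^ e * w" "\<not> p dvd w"
    unfolding e_def by (rule multiplicity_decompose')
  have "p ^ e > 0" using \<open>p \<ge> 3\<close> by simp
  have "n\<^sup>2 > 0" using \<open>n \<noteq> 0\<close> by simp
  then have "w > 0" using w(1) \<open>p ^ e > 0\<close> zero_less_mult_pos[of "p ^ e" w] by simp
  have "e > 0" using w p(2) by (intro Nat.gr0I) (auto simp: power2_eq_square)
  have "coprime (p ^ e) w" using prime_imp_coprime[OF p(1) w(2)] by simp
  then have q: "q = sigma (p ^ e) * sigma w"
    using sigma_mult[OF \<open>p ^ e > 0\<close> \<open>w > 0\<close>] assms(4) w(1) by simp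
  have s1: "sigma (p ^ e) \<ge> p ^ e" by (rule sigma_ge) fact
  have "p ^ e \<ge> p" using \<open>e > 0\<close> \<open>p \<ge> 3\<close> by (simp add: self_le_power)
  have "sigma w \<ge> w" by (rule sigma_ge) fact
  have "sigma (p ^ e) \<noteq> 1" using s1 \<open>p ^ e \<ge> p\<close> \<open>p \<ge> 3\<close> by linarith
  moreover have "sigma (p ^ e) dvd q" using q by simp
  ultimately have "sigma (p ^ e) = q"
    using assms(3) order.trans[OF less_imp_le[OF \<open>p ^ e > 0\<close>] s1] unfolding prime_int_iff by blast
  then have "sigma w = 1" using q prime_gt_0_int[OF assms(3)] by auto
  then have "w = 1" using \<open>sigma w \<ge> w\<close> \<open>w > 0\<close> by linarith
  then have n2: "n\<^sup>2 = p ^ e" using w(1) by simp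
  define P where "P = p ^ e"
  have "(1 - p) * q = 1 - p * P"
    using sigma_prime_power[OF p(1), of e] one_diff_power_eq[of p "Suc e"] \<open>sigma (p ^ e) = q\<close>
    by (simp add: lessThan_Suc_atMost P_def)
  moreover have "q \<ge> 2 * P - 1"
    using assms(5)[unfolded n2] mult_right_mono[OF assms(2) less_imp_le[OF \<open>p ^ e > 0\<close>]]
    unfolding P_def by linarith
  then have "(p - 1) * (2 * P - 1) \<le> (p - 1) * q" using \<open>p \<ge> 3\<close> by (intro mult_left_mono) auto
  ultimately have "(p - 2) * (P - 1) \<le> 0" by (simp add: algebra_simps)
  moreover have "(p - 2) * (P - 1) > 0"
    using \<open>p \<ge> 3\<close> \<open>p ^ e \<ge> p\<close> by (intro mult_pos_pos) (auto simp: P_def)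
  ultimately show False by simp
qed

section \<open>Odd multiply perfect numbers\<close>

theorem theorem3p3:
  fixes k N n q :: int and \<alpha> :: nat
  assumes "k > 0" and "[k = 2] (mod 4)"
    and "odd N" and "k_perfect k N"
    and "prime q" and "N = n ^ 2 * q ^ \<alpha>" and "\<not> q dvd n"
    and "[q = 1] (mod 4)" and "[\<alpha> = 1] (mod 4)"
  shows "(\<alpha> = 1 \<longrightarrow> rat_of_int (sigma (n ^ 2)) / rat_of_int q > 1)
    \<and> (\<alpha> > 1 \<and> (\<exists>m::int. rat_of_int k / 2 = rat_of_int (m ^ 2)) \<longrightarrow>
         \<not> (\<exists>(n0::int) (l::int). (l = 1 \<or> prime l) \<and>
              rat_of_int (sigma (n ^ 2)) / rat_of_int (q ^ \<alpha>) = rat_of_int (l * n0 ^ 2)))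
    \<and> (\<alpha> > 1 \<and> (\<exists>(p::int) (m::int). prime p \<and> rat_of_int k / 2 = rat_of_int (p * m ^ 2)) \<longrightarrow>
         \<not> (\<exists>n0::int. rat_of_int (sigma (n ^ 2)) / rat_of_int (q ^ \<alpha>) = rat_of_int (n0 ^ 2)))
    \<and> (\<alpha> = 1
        \<or> (\<alpha> > 1 \<and> (\<exists>m::int. rat_of_int k / 2 = rat_of_int (m ^ 2)))
        \<or> (\<alpha> > 1 \<and> (\<exists>(p::int) (m::int). prime p \<and> rat_of_int k / 2 = rat_of_int (p * m ^ 2)))
       \<longrightarrow> sigma (n ^ 2) \<noteq> q ^ \<alpha>)"
proof -
  have q: "q > 1" using assms(5) by (rule prime_gt_1_int)
  have "odd n" "n \<noteq> 0" using assms(3,6) by auto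
  have n2: "n\<^sup>2 > 0" using \<open>n \<noteq> 0\<close> by simp
  have qa: "q ^ \<alpha> > 0" using q by simp
  have "coprime (n\<^sup>2) (q ^ \<alpha>)"
    using prime_imp_coprime[OF assms(5,7)] by (simp add: coprime_commute)
  then have perfect: "sigma (n\<^sup>2) * sigma (q ^ \<alpha>) = k * (n\<^sup>2 * q ^ \<alpha>)"
    using sigma_mult[OF n2 qa] assms(4,6) by (simp add: k_perfect_def)
  have sigma_pos: "sigma (n\<^sup>2) > 0" using sigma_ge[OF n2] n2 by linarith
  have quotient: "s * sigma (q ^ \<alpha>) = k * n\<^sup>2" "s \<noteq> 0"
    if "rat_of_int (sigma (n\<^sup>2)) / rat_of_int (q ^ \<alpha>) = rat_of_int s" for s
  proof -
    have "rat_of_int (sigma (n\<^sup>2)) = rat_of_int (s * q ^ \<alpha>)"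
      using that q by (simp add: field_simps)
    then have s: "sigma (n\<^sup>2) = s * q ^ \<alpha>" by (simp only: of_int_eq_iff)
    then have "q ^ \<alpha> * (s * sigma (q ^ \<alpha>)) = q ^ \<alpha> * (k * n\<^sup>2)"
      using perfect by (simp add: ac_simps)
    then show "s * sigma (q ^ \<alpha>) = k * n\<^sup>2" using q by simp
    show "s \<noteq> 0" using s sigma_pos by auto
  qed
  have half: "k = 2 * x" if "rat_of_int k / 2 = rat_of_int x" for x
  proof -
    have "rat_of_int k = rat_of_int (2 * x)" using that by simp
    then show ?thesis by (simp only: of_int_eq_iff)
  qed
  have part1: "rat_of_int (sigma (n\<^sup>2)) / rat_of_int q > 1" if "\<alpha> = 1"
  proof -
    have sq: "sigma (q ^ 1) = q + 1" using sigma_prime_power[OF assms(5), of 1] by simp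
    then have eq: "sigma (n\<^sup>2) * (q + 1) = k * n\<^sup>2 * q" using perfect that by simp
    then have "q dvd sigma (n\<^sup>2) * (q + 1)" by simp
    moreover have "coprime q (q + 1)" by simp
    ultimately have "q dvd sigma (n\<^sup>2)" by (simp add: coprime_dvd_mult_left_iff)
    then have "q \<le> sigma (n\<^sup>2)" using sigma_pos by (rule zdvd_imp_le)
    moreover have "sigma (n\<^sup>2) \<noteq> q"
    proof
      assume s: "sigma (n\<^sup>2) = q"
      have "q + 1 = k * n\<^sup>2" using eq s q by simp
      moreover have "k mod 4 = 2" using assms(2) by (simp add: cong_def)
      then have "k \<ge> 2" using assms(1) by presburger
      ultimately show False
        using sigma_square_ne_multiple_minus_one[OF \<open>odd n\<close> _ assms(5) s] by blast
    qed
    ultimately have "q < sigma (n\<^sup>2)" by simp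
    then show ?thesis using q by simp
  qed
  note ne = sigma_prime_power_ne_twice_prime_times_square[OF assms(5,8,9)]
  have part2: False if "\<alpha> > 1" "rat_of_int k / 2 = rat_of_int (m\<^sup>2)" "l = 1 \<or> prime l"
      "rat_of_int (sigma (n\<^sup>2)) / rat_of_int (q ^ \<alpha>) = rat_of_int (l * n0\<^sup>2)" for m l n0
  proof -
    \<comment> \<open>Multiplying \<open>s * sigma (q ^ \<alpha>) = k * n\<^sup>2\<close>, where \<open>s = l * n0\<^sup>2\<close>, by \<open>l\<close> makes the cofactor of
        \<open>sigma (q ^ \<alpha>)\<close> a square.\<close>
    have "sigma (q ^ \<alpha>) * (l * n0)\<^sup>2 = l * (l * n0\<^sup>2 * sigma (q ^ \<alpha>))"
      by (simp add: power2_eq_square)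
    also have "\<dots> = 2 * l * (m * n)\<^sup>2"
      unfolding quotient(1)[OF that(4)] half[OF that(2)] by (simp add: power_mult_distrib)
    finally show False using ne[OF that(1,3), of "l * n0" "m * n"] quotient(2)[OF that(4)] by simp
  qed
  have part3: False if "\<alpha> > 1" "prime p" "rat_of_int k / 2 = rat_of_int (p * m\<^sup>2)"
      "rat_of_int (sigma (n\<^sup>2)) / rat_of_int (q ^ \<alpha>) = rat_of_int (n0\<^sup>2)" for p m n0
  proof -
    have "sigma (q ^ \<alpha>) * n0\<^sup>2 = 2 * p * (m * n)\<^sup>2"
      using quotient(1)[OF that(4)] unfolding half[OF that(3)] by (simp add: power_mult_distrib ac_simps)
    then show False using ne[OF that(1), of p n0 "m * n"] that(2) quotient(2)[OF that(4)] by simp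
  qed
  have trivial_quotient: "rat_of_int (sigma (n\<^sup>2)) / rat_of_int (q ^ \<alpha>) = rat_of_int (1\<^sup>2)"
    if "sigma (n\<^sup>2) = q ^ \<alpha>"
    using that q by simp
  have part4: "sigma (n\<^sup>2) \<noteq> q ^ \<alpha>"
    if "\<alpha> = 1 \<or> \<alpha> > 1 \<and> (\<exists>m. rat_of_int k / 2 = rat_of_int (m\<^sup>2))
      \<or> \<alpha> > 1 \<and> (\<exists>p m. prime p \<and> rat_of_int k / 2 = rat_of_int (p * m\<^sup>2))"
  proof
    assume s: "sigma (n\<^sup>2) = q ^ \<alpha>"
    from that consider "\<alpha> = 1" | m where "\<alpha> > 1" "rat_of_int k / 2 = rat_of_int (m\<^sup>2)"
      | p m where "\<alpha> > 1" "prime p" "rat_of_int k / 2 = rat_of_int (p * m\<^sup>2)" by blast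
    then show False
    proof cases
      case 1
      then show False using part1 s q by simp
    next
      case 2
      then show False using part2[of m 1 1] trivial_quotient[OF s] by simp
    next
      case 3
      then show False using part3[of p m 1] trivial_quotient[OF s] by simp
    qed
  qed
  show ?thesis using part1 part2 part3 part4 by blast
qed

end
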